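(* Let $X$ be a connected, locally connected, Hausdorff, first countable, normal topological space, $V$ a finite dimensional Euclidean vector space, and $f:X\to V$ a continuous closed map that has local convexity data and is locally fiber connected. Then: (i) all fibers of $f$ are connected; (ii) $f$ is open onto its image; (iii) the image $f(X)$ is a closed convex subset of $V$.
   Context: A subset $C\subset V$ is a cone with vertex $v_0$ if $v_0\in C$ and $(1-\lambda)v_0+\lambda v\in C$ for every $\lambda\ge 0$ and every $v\in C$, $v\ne v_0$; it is a convex cone if it is moreover convex. A continuous map $f:X\to V$ has local convexity data if for each $x\in X$ and every sufficiently small open neighborhood $U_x$ of $x$ there is a convex cone $C_x\subset V$ with vertex $f(x)$, endowed with the subspace topology from $V$, such that (VN) $f(U_x)\subset C_x$ and $f(U_x)$ is a neighborhood of $f(x)$ in $C_x$; and (SLO) $f|_{U_x}:U_x\to C_x$ is an open map, and for every neighborhood $U'_x\subset U_x$ of $x$ the set $f(U'_x)$ is a neighborhood of $f(x)$ in $C_x$. A subset $A\subset X$ satisfies condition (LFC) if for every $a\in A$, the set $A$ does not intersect two different connected components of the fiber $f^{-1}(f(a))$. The map $f$ is locally fiber connected if for every $x\in X$, every open neighborhood of $x$ contains a neighborhood $U_x$ of $x$ satisfying (LFC). "Open onto its image" means $f:X\to f(X)$ is open for the subspace topology on $f(X)$. *)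

theory Defs
  imports "HOL-Analysis.Analysis"
begin

definition cone_with_vertex :: "'b::real_vector set \<Rightarrow> 'b \<Rightarrow> bool" where
  "cone_with_vertex C v0 \<longleftrightarrow> v0 \<in> C \<and>
     (\<forall>t::real. t \<ge> 0 \<longrightarrow> (\<forall>v\<in>C. v \<noteq> v0 \<longrightarrow> (1 - t) *\<^sub>R v0 + t *\<^sub>R v \<in> C))"

definition convex_cone_with_vertex :: "'b::real_vector set \<Rightarrow> 'b \<Rightarrow> bool" where
  "convex_cone_with_vertex C v0 \<longleftrightarrow> cone_with_vertex C v0 \<and> convex C"

definition is_nbhd :: "'a topology \<Rightarrow> 'a set \<Rightarrow> 'a \<Rightarrow> bool" where
  "is_nbhd T N p \<longleftrightarrow> (\<exists>G. openin T G \<and> p \<in> G \<and> G \<subseteq> N)"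

definition VN_SLO :: "'a topology \<Rightarrow> ('a \<Rightarrow> 'b::real_normed_vector) \<Rightarrow> 'a \<Rightarrow> 'a set \<Rightarrow> 'b set \<Rightarrow> bool" where
  "VN_SLO X f x U C \<longleftrightarrow>
     f ` U \<subseteq> C \<and> is_nbhd (subtopology euclidean C) (f ` U) (f x) \<and>
     open_map (subtopology X U) (subtopology euclidean C) f \<and>
     (\<forall>U'. U' \<subseteq> U \<and> is_nbhd X U' x \<longrightarrow> is_nbhd (subtopology euclidean C) (f ` U') (f x))"

definition has_local_convexity_data :: "'a topology \<Rightarrow> ('a \<Rightarrow> 'b::real_normed_vector) \<Rightarrow> bool" where
  "has_local_convexity_data X f \<longleftrightarrow>
     (\<forall>x\<in>topspace X. \<exists>W. openin X W \<and> x \<in> W \<and>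
        (\<forall>U. openin X U \<and> x \<in> U \<and> U \<subseteq> W \<longrightarrow>
           (\<exists>C. convex_cone_with_vertex C (f x) \<and> VN_SLO X f x U C)))"

definition LFC :: "'a topology \<Rightarrow> ('a \<Rightarrow> 'b) \<Rightarrow> 'a set \<Rightarrow> bool" where
  "LFC X f A \<longleftrightarrow>
     (\<forall>a\<in>A. \<forall>K1 \<in> connected_components_of (subtopology X {y \<in> topspace X. f y = f a}).
        \<forall>K2 \<in> connected_components_of (subtopology X {y \<in> topspace X. f y = f a}).
          K1 \<inter> A \<noteq> {} \<and> K2 \<inter> A \<noteq> {} \<longrightarrow> K1 = K2)"

definition locally_fiber_connected_map :: "'a topology \<Rightarrow> ('a \<Rightarrow> 'b) \<Rightarrow> bool" where
  "locally_fiber_connected_map X f \<longleftrightarrow>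
     (\<forall>x\<in>topspace X. \<forall>W. openin X W \<and> x \<in> W \<longrightarrow>
        (\<exists>U. U \<subseteq> W \<and> is_nbhd X U x \<and> LFC X f U))"

end

theory Submission
  imports Defs
begin

text \<open>
  Two points \<open>p\<close>, \<open>q\<close> of \<open>X\<close> lie in one component of \<open>f\<^sup>-\<^sup>1(S)\<close> for some large ball \<open>S\<close>. By
  closedness of \<open>f\<close> and normality this survives intersections of chains, so by Zorn's lemma there is
  a minimal compact convex \<open>S\<close> with this property, and this \<open>S\<close> is the segment from \<open>f p\<close> to
  \<open>f q\<close>: otherwise one could cut off a small cap of \<open>S\<close> around a point \<open>e\<close> of \<open>S\<close> farthest from
  a suitable center. Were every such cut to disconnect \<open>p\<close> from \<open>q\<close>, there would be pairs of points
  on the cut that are connected through the cap only; for shrinking caps these accumulate at one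
  component of the fiber over \<open>e\<close>, near which the local data connect them within the cut. Once any
  \<open>p\<close>, \<open>q\<close> are connected over the segment from \<open>f p\<close> to \<open>f q\<close>, the image is convex, and the case
  \<open>f p = f q\<close> shows that the fibers are connected.
\<close>

section \<open>Caps cut off from a compact set\<close>

text \<open>The ball around a suitable center \<open>z\<close> that reaches the farthest point
  \<open>e\<close> of \<open>S\<close> contains all of \<open>S\<close>; the functional is
  \<open>u = e - z\<close>. The quadratic bound is this containment rewritten, and it makes the caps
  of \<open>S\<close> above hyperplanes normal to \<open>u\<close> shrink to \<open>e\<close> as the
  hyperplanes rise to \<open>e\<close>.\<close>

lemma shrinking_caps:
  fixes S :: "'b::euclidean_space set"
  assumes S: "compact S" "s \<in> S" and s: "s \<notin> closed_segment a b"
  obtains e u where "e \<in> S" "\<And>x. x \<in> S \<Longrightarrow> (norm (x - e))\<^sup>2 \<le> 2 * (u \<bullet> e - u \<bullet> x)"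
    "u \<bullet> a < u \<bullet> e" "u \<bullet> b < u \<bullet> e"
proof -
  obtain w \<beta> where w: "w \<bullet> s < \<beta>" "\<forall>x\<in>closed_segment a b. \<beta> < w \<bullet> x"
    using separating_hyperplane_closed_point[of "closed_segment a b" s] s by auto
  have wab: "0 < w \<bullet> (a - s)" "0 < w \<bullet> (b - s)"
    using w by (auto simp: inner_diff_right) (meson ends_in_segment less_trans)+
  \<comment> \<open>Moving the center from \<open>s\<close> along \<open>w\<close> by this factor
    brings it strictly closer to \<open>a\<close> and \<open>b\<close> than to \<open>s\<close>,
    hence also than to the farthest point \<open>e\<close>.\<close>
  define t where "t = max ((norm (a - s))\<^sup>2 / (w \<bullet> (a - s))) ((norm (b - s))\<^sup>2 / (w \<bullet> (b - s)))"
  have t: "(norm (a - s))\<^sup>2 \<le> t * (w \<bullet> (a - s))" "(norm (b - s))\<^sup>2 \<le> t * (w \<bullet> (b - s))"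
    using wab by (simp_all add: t_def flip: pos_divide_le_eq)
  have ne: "a \<noteq> s" "b \<noteq> s"
    using s by auto
  define z where "z = s + t *\<^sub>R w"
  have closer: "norm (d - z) < norm (s - z)" if "d \<noteq> s" "(norm (d - s))\<^sup>2 \<le> t * (w \<bullet> (d - s))" for d
  proof -
    have "(norm (d - z))\<^sup>2 = (norm (d - s))\<^sup>2 - 2 * (t * (w \<bullet> (d - s))) + (norm (s - z))\<^sup>2"
      unfolding z_def power2_norm_eq_inner by (simp add: algebra_simps inner_commute)
    moreover have "(norm (d - s))\<^sup>2 > 0"
      using that by simp
    ultimately have "(norm (d - z))\<^sup>2 < (norm (s - z))\<^sup>2"
      using that by linarith
    then show ?thesis
      by (simp add: power2_less_imp_less)
  qed
  obtain e where e: "e \<in> S" "\<And>x. x \<in> S \<Longrightarrow> dist z x \<le> dist z e"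
    using distance_attains_sup[of S z] S by blast
  have far: "norm (x - z) \<le> norm (e - z)" if "x \<in> S" for x
    using e(2)[OF that] by (simp add: dist_norm norm_minus_commute)
  \<comment> \<open>Points strictly inside the ball lie strictly below its tangent hyperplane at
    \<open>e\<close>.\<close>
  have below: "(e - z) \<bullet> d < (e - z) \<bullet> e" if "norm (d - z) < norm (s - z)" for d
  proof -
    have lt: "norm (d - z) < norm (e - z)"
      using that far[OF S(2)] by simp
    have "(e - z) \<bullet> (d - z) \<le> norm (e - z) * norm (d - z)"
      by (rule norm_cauchy_schwarz)
    also have "\<dots> < norm (e - z) * norm (e - z)"
      using lt by (intro mult_strict_left_mono) (auto intro: le_less_trans[OF norm_ge_zero])
    also have "\<dots> = (e - z) \<bullet> (e - z)"
      by (simp add: power2_norm_eq_inner flip: power2_eq_square)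
    finally show ?thesis
      by (simp add: inner_diff_right)
  qed
  show thesis
  proof (rule that[OF e(1)])
    fix x assume x: "x \<in> S"
    have "(norm (x - z))\<^sup>2 \<le> (norm (e - z))\<^sup>2"
      using far[OF x] by (simp add: power_mono)
    then show "(norm (x - e))\<^sup>2 \<le> 2 * ((e - z) \<bullet> e - (e - z) \<bullet> x)"
      unfolding power2_norm_eq_inner by (simp add: algebra_simps inner_commute)
  qed (use below closer ne t in auto)
qed

section \<open>Connectedness over subsets of the target\<close>

locale local_convexity_map =
  fixes X :: "'a topology" and f :: "'a \<Rightarrow> 'b::euclidean_space"
  assumes connected: "connected_space X"
    and normal: "normal_space X"
    and continuous: "continuous_map X euclidean f"
    and closed_map: "closed_map X euclidean f"
    and convexity_data: "has_local_convexity_data X f"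
    and fiber_connected: "locally_fiber_connected_map X f"
begin

definition pre :: "'b set \<Rightarrow> 'a set" where
  "pre S = {x \<in> topspace X. f x \<in> S}"

text \<open>Components of preimages are encoded as a relation, so that connectedness over different
  sets can be compared by \<open>joined_mono\<close> and chained.\<close>

definition joined :: "'b set \<Rightarrow> 'a \<Rightarrow> 'a \<Rightarrow> bool" where
  "joined S = connected_component_of (subtopology X (pre S))"

lemma pre_iff: "x \<in> pre S \<longleftrightarrow> x \<in> topspace X \<and> f x \<in> S"
  by (simp add: pre_def)

lemma topspace_pre: "topspace (subtopology X (pre S)) = pre S"
  by (auto simp: pre_def)

lemma joined_iff:
  "joined S x y \<longleftrightarrow> (\<exists>L. connectedin X L \<and> L \<subseteq> pre S \<and> x \<in> L \<and> y \<in> L)"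
  by (auto simp: joined_def connected_component_of_def connectedin_subtopology)

lemma joined_in: "joined S x y \<Longrightarrow> x \<in> pre S \<and> y \<in> pre S"
  by (auto simp: joined_iff)

lemma joined_refl: "joined S x x \<longleftrightarrow> x \<in> pre S"
  using connected_component_of_refl[of "subtopology X (pre S)" x] unfolding joined_def topspace_pre .

lemma joined_sym: "joined S x y \<Longrightarrow> joined S y x"
  by (auto simp: joined_iff)

lemma joined_trans: "joined S x y \<Longrightarrow> joined S y z \<Longrightarrow> joined S x z"
  unfolding joined_def by (rule connected_component_of_trans)

lemma joined_mono: "joined S x y \<Longrightarrow> S \<subseteq> T \<Longrightarrow> joined T x y"
  unfolding joined_def by (erule connected_component_of_mono) (auto simp: pre_def)

lemma openin_pre: "open G \<Longrightarrow> openin X (pre G)"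
  using continuous unfolding pre_def continuous_map by auto

lemma closedin_pre: "closed G \<Longrightarrow> closedin X (pre G)"
  using continuous unfolding pre_def continuous_map_closedin by auto

text \<open>Both alternatives occur later: closed pairs when gluing components across a cut, open
  pairs elsewhere.\<close>

lemma connected_on_side:
  assumes "connectedin X L" "openin X E1 \<and> openin X E2 \<or> closedin X E1 \<and> closedin X E2"
    and "L \<subseteq> E1 \<union> E2" "E1 \<inter> E2 \<inter> L = {}" "x \<in> L" "x \<in> E1" "y \<in> L"
  shows "y \<in> E1"
proof (rule ccontr)
  assume "y \<notin> E1"
  then have *: "L \<subseteq> E1 \<union> E2" "E1 \<inter> E2 \<inter> L = {}" "E1 \<inter> L \<noteq> {}" "E2 \<inter> L \<noteq> {}"
    using assms by auto
  from assms(2) show False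
  proof
    assume "openin X E1 \<and> openin X E2"
    then show False
      using assms(1) * unfolding connectedin by meson
  next
    assume "closedin X E1 \<and> closedin X E2"
    then show False
      using assms(1) * unfolding connectedin_closedin by meson
  qed
qed

section \<open>Local structure\<close>

text \<open>One open set serves both local hypotheses, being chosen inside an (LFC) neighborhood
  that lies where convexity data exist. Openness of \<open>f\<close> into \<open>C\<close> is
  phrased with ambient open sets \<open>G\<close>, ready for separation arguments in
  \<open>C\<close>.\<close>

lemma chart:
  assumes x: "x \<in> topspace X"
  obtains U C where "openin X U" "x \<in> U" "convex C" "f ` U \<subseteq> C"
    "\<And>O'. openin X O' \<Longrightarrow> \<exists>G. open G \<and> f ` (U \<inter> O') = C \<inter> G"
    "\<And>u u'. u \<in> U \<Longrightarrow> u' \<in> U \<Longrightarrow> f u = f u' \<Longrightarrow> joined {f u} u u'"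
proof -
  obtain W where W: "openin X W" "x \<in> W" and WU: "\<And>U. openin X U \<Longrightarrow> x \<in> U \<Longrightarrow> U \<subseteq> W \<Longrightarrow>
      \<exists>C. convex_cone_with_vertex C (f x) \<and> VN_SLO X f x U C"
    using convexity_data x unfolding has_local_convexity_data_def by meson
  obtain U' where U': "U' \<subseteq> W" "is_nbhd X U' x" "LFC X f U'"
    using fiber_connected x W unfolding locally_fiber_connected_map_def by meson
  then obtain U where U: "openin X U" "x \<in> U" "U \<subseteq> U'"
    unfolding is_nbhd_def by blast
  then obtain C where C: "convex_cone_with_vertex C (f x)" "VN_SLO X f x U C"
    using WU U' by (meson order_trans)
  have *: "\<exists>G. open G \<and> f ` (U \<inter> O') = C \<inter> G" if "openin X O'" for O'
  proof -
    have "openin (subtopology X U) (U \<inter> O')"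
      using that by (rule openin_subtopology_Int2)
    then have "openin (top_of_set C) (f ` (U \<inter> O'))"
      using C unfolding VN_SLO_def open_map_def by blast
    then show ?thesis
      by (auto simp: openin_open)
  qed
  have **: "joined {f u} u u'" if u: "u \<in> U" "u' \<in> U" "f u = f u'" for u u'
  proof -
    have pre: "{y \<in> topspace X. f y = f u} = pre {f u}"
      by (auto simp: pre_def)
    have top: "u \<in> pre {f u}" "u' \<in> pre {f u}"
      using u U openin_subset by (auto simp: pre_def)
    let ?Y = "subtopology X (pre {f u})"
    let ?K = "connected_component_of_set ?Y"
    have K: "?K w \<in> connected_components_of ?Y \<and> w \<in> ?K w" if "w \<in> pre {f u}" for w
      using that by (simp add: connected_component_in_connected_components_of
          connected_component_of_refl topspace_pre del: topspace_subtopology)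
    \<comment> \<open>(LFC) for the larger set \<open>U'\<close> suffices: the fiber components of
      \<open>u\<close> and \<open>u'\<close> both meet \<open>U'\<close>, at these very
      points.\<close>
    have "\<forall>K1\<in>connected_components_of ?Y. \<forall>K2\<in>connected_components_of ?Y.
        K1 \<inter> U' \<noteq> {} \<and> K2 \<inter> U' \<noteq> {} \<longrightarrow> K1 = K2"
      using U'(3) u(1) U(3) unfolding LFC_def pre[symmetric] by blast
    moreover have "?K u \<inter> U' \<noteq> {}" "?K u' \<inter> U' \<noteq> {}"
      using K top u U(3) by blast+
    ultimately have "?K u = ?K u'"
      using K top by simp
    then show ?thesis
      using K[OF top(2)] unfolding joined_def by blast
  qed
  show thesis
    using that[OF U(1,2) _ _ * **] C unfolding VN_SLO_def convex_cone_with_vertex_def by blast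
qed

text \<open>The fiber components that meet the chart form a connected set over each small convex \<open>T\<close>,
  because the chart map is open and has convex image over \<open>T\<close>.\<close>

lemma locally_joined:
  assumes x: "x \<in> topspace X"
  obtains N \<delta> where "openin X N" "x \<in> N" "0 < \<delta>"
    "\<And>T u u'. convex T \<Longrightarrow> T \<subseteq> ball (f x) \<delta> \<Longrightarrow> u \<in> N \<Longrightarrow> u' \<in> N \<Longrightarrow> f u \<in> T \<Longrightarrow> f u' \<in> T
      \<Longrightarrow> joined T u u'"
proof -
  obtain U C where U: "openin X U" "x \<in> U" and C: "convex C" "f ` U \<subseteq> C"
    and op: "\<And>O'. openin X O' \<Longrightarrow> \<exists>G. open G \<and> f ` (U \<inter> O') = C \<inter> G"
    and fib: "\<And>u u'. u \<in> U \<Longrightarrow> u' \<in> U \<Longrightarrow> f u = f u' \<Longrightarrow> joined {f u} u u'"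
    using chart[OF x] by metis
  obtain G where G: "open G" "f ` U = C \<inter> G"
    using op[of U] U by auto
  then obtain \<delta> where \<delta>: "\<delta> > 0" "ball (f x) \<delta> \<subseteq> G"
    using U by (metis Int_iff image_eqI open_contains_ball)
  have UX: "U \<subseteq> topspace X"
    using U openin_subset by blast
  have "joined T u u'"
    if T: "convex T" "T \<subseteq> ball (f x) \<delta>" and u: "u \<in> U" "u' \<in> U" "f u \<in> T" "f u' \<in> T" for T u u'
  proof -
    define Z where "Z = {y. \<exists>w\<in>U. f w \<in> T \<and> joined {f w} w y}"
    have Zpre: "Z \<subseteq> pre T"
      unfolding Z_def using joined_in pre_iff by fastforce
    have UZ: "w \<in> Z" if "w \<in> U" "f w \<in> T" for w
      using that UX by (auto simp: Z_def joined_refl pre_iff intro!: bexI[of _ w])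
    \<comment> \<open>As \<open>T\<close> lies in \<open>G\<close>, the values in \<open>T\<close>
      attained on \<open>U\<close> fill the convex set \<open>C \<inter> T\<close>. A separation of
      \<open>Z\<close> will be pushed down to a separation of this set.\<close>
    have JT: "f ` U \<inter> T = C \<inter> T"
      using G \<delta> T by auto
    have "connectedin X Z"
      unfolding connectedin
    proof (intro conjI notI)
      show "Z \<subseteq> topspace X"
        using Zpre by (auto simp: pre_def)
      assume "\<exists>E1 E2. openin X E1 \<and> openin X E2 \<and> Z \<subseteq> E1 \<union> E2 \<and> E1 \<inter> E2 \<inter> Z = {} \<and>
        E1 \<inter> Z \<noteq> {} \<and> E2 \<inter> Z \<noteq> {}"
      then obtain E1 E2 where E: "openin X E1" "openin X E2" "Z \<subseteq> E1 \<union> E2" "E1 \<inter> E2 \<inter> Z = {}"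
        "E1 \<inter> Z \<noteq> {}" "E2 \<inter> Z \<noteq> {}" by blast
      \<comment> \<open>A fiber component inside \<open>Z\<close> is connected, so it cannot meet
        both sides.\<close>
      have side1: "z \<in> E1" if w: "w \<in> U" "f w \<in> T" "joined {f w} w y" "joined {f w} w z" "y \<in> E1" for w y z
      proof -
        have "joined {f w} y z"
          using w joined_sym joined_trans by blast
        then obtain L where L: "connectedin X L" "L \<subseteq> pre {f w}" "y \<in> L" "z \<in> L"
          unfolding joined_iff by blast
        have "L \<subseteq> Z"
          unfolding Z_def using L w joined_iff joined_trans by blast
        then show ?thesis
          using connected_on_side[of L E1 E2 y z] L E w by blast
      qed
      have side2: "z \<in> E2" if w: "w \<in> U" "f w \<in> T" "joined {f w} w y" "joined {f w} w z" "y \<in> E2" for w y z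
        using side1[of w z y] that E unfolding Z_def by blast
      obtain G1 where G1: "open G1" "f ` (U \<inter> E1) = C \<inter> G1"
        using op[OF E(1)] by blast
      obtain G2 where G2: "open G2" "f ` (U \<inter> E2) = C \<inter> G2"
        using op[OF E(2)] by blast
      have "C \<inter> T \<subseteq> G1 \<union> G2"
      proof
        fix v assume v: "v \<in> C \<inter> T"
        then have "v \<in> f ` U"
          using JT by auto
        then obtain w where w: "w \<in> U" "f w = v"
          by auto
        have "w \<in> E1 \<or> w \<in> E2"
          using UZ[of w] v w E(3) by auto
        then have "v \<in> f ` (U \<inter> E1) \<or> v \<in> f ` (U \<inter> E2)"
          using w by auto
        then show "v \<in> G1 \<union> G2"
          using G1(2) G2(2) by auto
      qed
      \<comment> \<open>Two points of \<open>U\<close> over a common value lie in one fiber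
        component, hence on the same side.\<close>
      moreover have "G1 \<inter> G2 \<inter> (C \<inter> T) = {}"
      proof (rule ccontr)
        assume "\<not> ?thesis"
        then obtain v where v: "v \<in> C" "v \<in> T" "v \<in> G1" "v \<in> G2" by blast
        have "v \<in> f ` (U \<inter> E1)"
          using G1(2) v by simp
        then obtain w1 where w1: "w1 \<in> U" "w1 \<in> E1" "f w1 = v"
          by auto
        have "v \<in> f ` (U \<inter> E2)"
          using G2(2) v by simp
        then obtain w2 where w2: "w2 \<in> U" "w2 \<in> E2" "f w2 = v"
          by auto
        have "w2 \<in> E1"
          using side1[of w1 w1 w2] fib[of w1 w2] fib[of w1 w1] w1 w2 v by auto
        then show False
          using w2 UZ v E by blast
      qed
      moreover have "G1 \<inter> (C \<inter> T) \<noteq> {}"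
      proof -
        obtain y w where y: "y \<in> E1" "w \<in> U" "f w \<in> T" "joined {f w} w y"
          using E(5) unfolding Z_def by blast
        then have "w \<in> E1"
          using side1[of w y w] fib[of w w] by blast
        then show ?thesis
          using y G1 by blast
      qed
      moreover have "G2 \<inter> (C \<inter> T) \<noteq> {}"
      proof -
        obtain y w where y: "y \<in> E2" "w \<in> U" "f w \<in> T" "joined {f w} w y"
          using E(6) unfolding Z_def by blast
        then have "w \<in> E2"
          using side2[of w y w] fib[of w w] by blast
        then show ?thesis
          using y G2 by blast
      qed
      ultimately have "\<not> connected (C \<inter> T)"
        unfolding connected_def using G1(1) G2(1) by blast
      then show False
        using C T convex_Int convex_connected by blast
    qed
    then show ?thesis
      unfolding joined_iff using Zpre UZ u by blast
  qed
  then show thesis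
    using that[OF U \<delta>(1)] by blast
qed

section \<open>Components of preimages of convex sets\<close>

text \<open>Around each point \<open>y\<close> of the component, \<open>locally_joined\<close>
  applies to the convex set \<open>S \<inter> ball (f y) \<delta>\<close> and joins \<open>y\<close>
  to all nearby points of \<open>pre S\<close>.\<close>

lemma component_openin:
  assumes "convex S"
  shows "\<exists>E. openin X E \<and> {y. joined S x y} = E \<inter> pre S"
proof -
  have "\<exists>N. openin X N \<and> y \<in> N \<and> N \<inter> pre S \<subseteq> {y. joined S x y}" if y: "joined S x y" for y
  proof -
    have yX: "y \<in> topspace X" "f y \<in> S"
      using joined_in[OF y] by (auto simp: pre_iff)
    obtain N \<delta> where N: "openin X N" "y \<in> N" "0 < \<delta>"
      and j: "\<And>T u u'. convex T \<Longrightarrow> T \<subseteq> ball (f y) \<delta> \<Longrightarrow> u \<in> N \<Longrightarrow> u' \<in> N \<Longrightarrow> f u \<in> T \<Longrightarrow> f u' \<in> T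
      \<Longrightarrow> joined T u u'"
      using locally_joined[OF yX(1)] by metis
    have "joined S x u" if "u \<in> N \<inter> pre (ball (f y) \<delta>)" "u \<in> pre S" for u
    proof -
      have "joined (S \<inter> ball (f y) \<delta>) y u"
        by (rule j) (use assms that N yX in \<open>auto simp: pre_iff convex_Int\<close>)
      then show ?thesis
        using y joined_trans joined_mono by blast
    qed
    moreover have "openin X (N \<inter> pre (ball (f y) \<delta>))"
      using N openin_pre by blast
    ultimately show ?thesis
      using N yX by (intro exI[of _ "N \<inter> pre (ball (f y) \<delta>)"]) (auto simp: pre_iff)
  qed
  then obtain N where N: "\<And>y. joined S x y \<Longrightarrow> openin X (N y) \<and> y \<in> N y \<and> N y \<inter> pre S \<subseteq> {y. joined S x y}"
    by metis
  show ?thesis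
    using N joined_in by (intro exI[of _ "\<Union>y\<in>{y. joined S x y}. N y"]) auto
qed

lemma saturated_openin:
  assumes "convex S" "A \<subseteq> pre S" "\<And>x y. x \<in> A \<Longrightarrow> joined S x y \<Longrightarrow> y \<in> A"
  shows "\<exists>E. openin X E \<and> A = E \<inter> pre S"
proof -
  obtain E where E: "\<And>x. openin X (E x) \<and> {y. joined S x y} = E x \<inter> pre S"
    using component_openin[OF assms(1)] by metis
  have "A = (\<Union>x\<in>A. {y. joined S x y})"
    using assms joined_refl by blast
  also have "\<dots> = (\<Union>x\<in>A. E x) \<inter> pre S"
    using E by blast
  finally show ?thesis
    using E by (intro exI[of _ "\<Union>x\<in>A. E x"]) auto
qed

text \<open>The complement in \<open>pre S\<close> of a union of components is again a union of
  components, hence relatively open, and \<open>pre S\<close> is closed.\<close>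

lemma saturated_closedin:
  assumes S: "convex S" "closed S" and A: "A \<subseteq> pre S" "\<And>x y. x \<in> A \<Longrightarrow> joined S x y \<Longrightarrow> y \<in> A"
  shows "closedin X A" "closedin X (pre S - A)"
proof -
  have compl: "closedin X (pre S - B)" if B: "B \<subseteq> pre S" "\<And>x y. x \<in> B \<Longrightarrow> joined S x y \<Longrightarrow> y \<in> B" for B
  proof -
    have "\<exists>E. openin X E \<and> B = E \<inter> pre S"
      by (rule saturated_openin[OF S(1) B(1)]) (erule (1) B(2))
    then obtain E where "openin X E" "B = E \<inter> pre S"
      by (elim exE conjE)
    moreover have "pre S - E \<inter> pre S = pre S - E"
      by blast
    ultimately show ?thesis
      using closedin_diff[OF closedin_pre[OF S(2)]] by simp
  qed
  show "closedin X (pre S - A)"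
    using compl A by blast
  have "y \<in> pre S - A" if "x \<in> pre S - A" "joined S x y" for x y
    using that A(2)[OF _ joined_sym, of y x] joined_in by blast
  then have "closedin X (pre S - (pre S - A))"
    using compl[of "pre S - A"] by blast
  then show "closedin X A"
    using A by (simp add: double_diff)
qed

text \<open>This is the tube lemma for closed maps: \<open>W\<close> is the complement of the closed
  image of the complement of \<open>E\<close>.\<close>

lemma closed_map_tube:
  assumes "openin X E" "pre S \<subseteq> E"
  obtains W where "open W" "S \<subseteq> W" "pre W \<subseteq> E"
proof
  have "closed (f ` (topspace X - E))"
    using closed_map assms(1) unfolding closed_map_def by auto
  then show "open (- f ` (topspace X - E))"
    by auto
qed (use assms in \<open>auto simp: pre_def\<close>)

text \<open>The component of \<open>p\<close> and the rest of \<open>pre S\<close> are disjoint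
  closed sets, so normality separates them; the tube lemma extends the splitting to a neighborhood
  \<open>W\<close> of \<open>S\<close>. Non-connectedness over \<open>S\<close> thus persists over
  all sets close to \<open>S\<close>.\<close>

lemma separate_component:
  assumes S: "convex S" "closed S" and p: "p \<in> pre S"
  obtains E1 E2 W where "openin X E1" "openin X E2" "E1 \<inter> E2 = {}" "{y. joined S p y} \<subseteq> E1"
    "{y \<in> pre S. \<not> joined S p y} \<subseteq> E2" "open W" "S \<subseteq> W" "pre W \<subseteq> E1 \<union> E2"
proof -
  let ?A = "{y. joined S p y}" and ?B = "{y \<in> pre S. \<not> joined S p y}"
  have "?A \<subseteq> pre S" "\<And>x y. x \<in> ?A \<Longrightarrow> joined S x y \<Longrightarrow> y \<in> ?A"
    using joined_in joined_trans by blast+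
  then have "closedin X ?A" "closedin X (pre S - ?A)"
    using saturated_closedin[OF S, of ?A] by blast+
  moreover have "pre S - ?A = ?B"
    by blast
  moreover have "disjnt ?A ?B"
    by (auto simp: disjnt_def)
  ultimately have "\<exists>E1 E2. openin X E1 \<and> openin X E2 \<and> ?A \<subseteq> E1 \<and> ?B \<subseteq> E2 \<and> disjnt E1 E2"
    by (intro normal[unfolded normal_space_def, rule_format]) simp
  then obtain E1 E2 where E: "openin X E1" "openin X E2" "?A \<subseteq> E1" "?B \<subseteq> E2" "disjnt E1 E2"
    by (elim exE conjE)
  obtain W where W: "open W" "S \<subseteq> W" "pre W \<subseteq> E1 \<union> E2"
    by (rule closed_map_tube[of "E1 \<union> E2" S]) (use E in auto)
  show thesis
    by (rule that[of E1 E2 W]) (use E W in \<open>auto simp: disjnt_def\<close>)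
qed

text \<open>Without such a pair, the component \<open>A\<close> of \<open>p\<close> over
  \<open>S'\<close> together with the components \<open>B\<close> over \<open>T\<close> attached to
  it would be disjoint from the remaining pieces \<open>A'\<close> and \<open>B'\<close>. These are
  two closed sets covering \<open>pre (S' \<union> T)\<close>, and they would separate
  \<open>p\<close> from \<open>q\<close>.\<close>

lemma joined_across_cut:
  assumes S': "convex S'" "closed S'" and T: "convex T" "closed T"
    and j: "joined (S' \<union> T) p q" and nj: "\<not> joined S' p q"
    and p: "p \<in> pre S'" and q: "q \<in> pre S'"
  obtains x y where "f x \<in> S' \<inter> T" "f y \<in> S' \<inter> T" "joined S' p x" "\<not> joined S' p y" "joined T x y"
proof (rule ccontr)
  note witness = that
  assume "\<not> thesis"
  then have none: False if "f x \<in> S' \<inter> T" "f y \<in> S' \<inter> T" "joined S' p x" "\<not> joined S' p y" "joined T x y" for x y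
    using witness that by blast
  define A where "A = {z. joined S' p z}"
  define A' where "A' = {z \<in> pre S'. \<not> joined S' p z}"
  define B where "B = {z. \<exists>x. f x \<in> S' \<and> joined S' p x \<and> joined T x z}"
  define B' where "B' = pre T - B"
  have "A \<subseteq> pre S'" "\<And>x y. x \<in> A \<Longrightarrow> joined S' x y \<Longrightarrow> y \<in> A"
    unfolding A_def using joined_in joined_trans by blast+
  then have "closedin X A" "closedin X (pre S' - A)"
    using saturated_closedin[OF S', of A] by blast+
  moreover have "pre S' - A = A'"
    unfolding A_def A'_def by blast
  moreover have "B \<subseteq> pre T" "\<And>x y. x \<in> B \<Longrightarrow> joined T x y \<Longrightarrow> y \<in> B"
    unfolding B_def using joined_in joined_trans by blast+
  then have "closedin X B" "closedin X B'"
    unfolding B'_def using saturated_closedin[OF T, of B] by blast+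
  ultimately have cl: "closedin X (A \<union> B)" "closedin X (A' \<union> B')"
    by auto
  have AA: "A \<inter> A' = {}" and BB: "B \<inter> B' = {}"
    by (auto simp: A_def A'_def B'_def)
  have AB: "A \<inter> B' = {}"
  proof -
    have "z \<in> B" if "z \<in> A" "z \<in> pre T" for z
      using that joined_in[of S' p z] joined_refl[of T z] unfolding A_def B_def by (auto simp: pre_iff)
    then show ?thesis
      unfolding B'_def by blast
  qed
  have BA: "A' \<inter> B = {}"
  proof -
    have False if z: "z \<in> A'" "z \<in> B" for z
    proof -
      obtain x where x: "f x \<in> S'" "joined S' p x" "joined T x z"
        using z unfolding B_def by blast
      then show False
        using none[of x z] z joined_in[of T x z] unfolding A'_def by (auto simp: pre_iff)
    qed
    then show ?thesis
      by blast
  qed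
  have dis: "(A \<union> B) \<inter> (A' \<union> B') = {}"
    using AA BB AB BA by blast
  obtain L where L: "connectedin X L" "L \<subseteq> pre (S' \<union> T)" "p \<in> L" "q \<in> L"
    using j unfolding joined_iff by blast
  have cover: "pre (S' \<union> T) \<subseteq> (A \<union> B) \<union> (A' \<union> B')"
    unfolding A_def A'_def B'_def by (auto simp: pre_iff)
  have "q \<in> A \<union> B"
  proof (rule connected_on_side[OF L(1)])
    show "p \<in> A \<union> B"
      using p joined_refl unfolding A_def by blast
    show "L \<subseteq> (A \<union> B) \<union> (A' \<union> B')"
      using L(2) cover by (rule subset_trans)
    show "(A \<union> B) \<inter> (A' \<union> B') \<inter> L = {}"
      unfolding dis by simp
  qed (use L cl in simp_all)
  moreover have "q \<in> A'"
    using q nj unfolding A'_def by blast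
  ultimately show False
    using dis by blast
qed

section \<open>Saturation by fiber components and cluster points\<close>

text \<open>Being interior to the saturation \<open>A\<close> spreads along a fiber component:
  within a chart, the map is open into \<open>C\<close>, so interiority at one point over
  \<open>f x\<close> passes to every other point over \<open>f x\<close>.\<close>

lemma openin_fiber_saturation:
  assumes O': "openin X O'"
  shows "openin X {x. \<exists>y\<in>O'. joined {f x} x y}"
proof -
  define A where "A = {x. \<exists>y\<in>O'. joined {f x} x y}"
  have AX: "A \<subseteq> topspace X"
    unfolding A_def using joined_in pre_iff by fastforce
  define I where "I = {x. \<exists>N. openin X N \<and> x \<in> N \<and> N \<subseteq> A}"
  have spread: "\<exists>U. openin X U \<and> x \<in> U \<and> (\<forall>z\<in>U. f z = f x \<longrightarrow> z \<in> I \<longrightarrow> (\<forall>z'\<in>U. f z' = f x \<longrightarrow> z' \<in> I))"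
    if x: "x \<in> topspace X" for x
  proof -
    obtain U C where U: "openin X U" "x \<in> U" and C: "f ` U \<subseteq> C"
      and op: "\<And>O'. openin X O' \<Longrightarrow> \<exists>G. open G \<and> f ` (U \<inter> O') = C \<inter> G"
      and fib: "\<And>u u'. u \<in> U \<Longrightarrow> u' \<in> U \<Longrightarrow> f u = f u' \<Longrightarrow> joined {f u} u u'"
      using chart[OF x] by metis
    have "z' \<in> I" if z: "z \<in> U" "f z = f x" "z \<in> I" "z' \<in> U" "f z' = f x" for z z'
    proof -
      obtain N where N: "openin X N" "z \<in> N" "N \<subseteq> A"
        using z unfolding I_def by blast
      obtain G where G: "open G" "f ` (U \<inter> N) = C \<inter> G"
        using op[OF N(1)] by blast
      \<comment> \<open>A point of \<open>U\<close> with value in \<open>G\<close> shares its value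
        with some \<open>w\<close> in \<open>U \<inter> N\<close>; both lie in one fiber component,
        and \<open>w\<close> is already in \<open>A\<close>.\<close>
      have "U \<inter> pre G \<subseteq> A"
      proof
        fix u assume u: "u \<in> U \<inter> pre G"
        then have "f u \<in> f ` (U \<inter> N)"
          unfolding G using C by (auto simp: pre_iff)
        then obtain w where w: "w \<in> U" "w \<in> N" "f w = f u"
          by auto
        then obtain y where "y \<in> O'" "joined {f w} w y"
          using N unfolding A_def by blast
        moreover have "joined {f u} u w"
          using fib[of u w] w u by auto
        ultimately show "u \<in> A"
          unfolding A_def using w joined_trans by force
      qed
      moreover have "f x \<in> G"
        using G N z by (metis Int_iff image_eqI)
      then have "z' \<in> U \<inter> pre G"
        using z U openin_subset by (fastforce simp: pre_iff)
      moreover have "openin X (U \<inter> pre G)"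
        using U G openin_pre by blast
      ultimately show ?thesis
        unfolding I_def by blast
    qed
    then show ?thesis
      using U by blast
  qed
  have "x \<in> I" if xA: "x \<in> A" for x
  proof -
    obtain y where y: "y \<in> O'" "joined {f x} x y"
      using xA unfolding A_def by blast
    have "z \<in> A" if "z \<in> O'" for z
      using that O' openin_subset[of X O'] unfolding A_def by (auto simp: joined_refl pre_iff intro!: bexI[of _ z])
    then have yI: "y \<in> I"
      using y O' unfolding I_def by blast
    obtain L where L: "connectedin X L" "L \<subseteq> pre {f x}" "x \<in> L" "y \<in> L"
      using y unfolding joined_iff by blast
    have L': "w \<in> topspace X \<and> f w = f x" if "w \<in> L" for w
      using that L by (auto simp: pre_iff)
    obtain U where U: "\<And>w. w \<in> L \<Longrightarrow> openin X (U w) \<and> w \<in> U w \<and>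
        (\<forall>z\<in>U w. f z = f w \<longrightarrow> z \<in> I \<longrightarrow> (\<forall>z'\<in>U w. f z' = f w \<longrightarrow> z' \<in> I))"
      using spread L' by metis
    \<comment> \<open>On \<open>L\<close> the charts around points of \<open>I\<close> meet only
      \<open>I\<close> and the others miss \<open>I\<close>, by \<open>spread\<close>; connectedness
      of \<open>L\<close> then carries \<open>I\<close> from \<open>y\<close> to
      \<open>x\<close>.\<close>
    define E1 where "E1 = (\<Union>w\<in>L \<inter> I. U w)"
    define E2 where "E2 = (\<Union>w\<in>L - I. U w)"
    have 1: "z \<in> I" if "z \<in> L" "z \<in> E1" for z
      using that U L' unfolding E1_def by fastforce
    have 2: "z \<notin> I" if "z \<in> L" "z \<in> E2" for z
      using that U L' unfolding E2_def by fastforce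
    have "x \<in> E1"
    proof (rule connected_on_side[OF L(1)])
      show "y \<in> E1" "L \<subseteq> E1 \<union> E2"
        using U yI L unfolding E1_def E2_def by blast+
      have "openin X E1" "openin X E2"
        unfolding E1_def E2_def using U by auto
      then show "openin X E1 \<and> openin X E2 \<or> closedin X E1 \<and> closedin X E2"
        by blast
      show "E1 \<inter> E2 \<inter> L = {}"
        using 1 2 by blast
    qed (use L in auto)
    then show ?thesis
      using 1 L by blast
  qed
  then have "openin X A"
    unfolding I_def using openin_subopen[of X A] by blast
  then show ?thesis
    unfolding A_def .
qed

text \<open>This replaces compactness of the fibers, which may fail.\<close>

lemma fiber_cluster_point:
  fixes s :: "nat \<Rightarrow> 'a"
  assumes s: "\<And>n. s n \<in> topspace X" and lim: "(\<lambda>n. f (s n)) \<longlonglongrightarrow> e" and ne: "\<And>n. f (s n) \<noteq> e"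
    and I: "infinite I"
  obtains x where "x \<in> pre {e}" "\<And>N. openin X N \<Longrightarrow> x \<in> N \<Longrightarrow> infinite {n \<in> I. s n \<in> N}"
proof (rule ccontr)
  note witness = that
  assume "\<not> thesis"
  then have "\<forall>x\<in>pre {e}. \<exists>N. openin X N \<and> x \<in> N \<and> finite {n \<in> I. s n \<in> N}"
    using witness by meson
  then obtain N where N: "\<And>x. x \<in> pre {e} \<Longrightarrow> openin X (N x) \<and> x \<in> N x \<and> finite {n \<in> I. s n \<in> N x}"
    by metis
  \<comment> \<open>The finitely many values attained by the sequence inside \<open>N x\<close> are
    removed. None of them is \<open>e\<close>, so \<open>M x\<close> is still a neighborhood of
    \<open>x\<close>, but contains no \<open>s n\<close> with \<open>n\<close> in
    \<open>I\<close>.\<close>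
  define M where "M x = N x \<inter> pre (- ((\<lambda>n. f (s n)) ` {n \<in> I. s n \<in> N x}))" for x
  have M: "openin X (M x) \<and> x \<in> M x" if "x \<in> pre {e}" for x
  proof
    show "openin X (M x)"
      unfolding M_def using N[OF that] by (intro openin_Int openin_pre open_Compl finite_imp_closed) auto
    show "x \<in> M x"
      using N[OF that] that ne unfolding M_def by (auto simp: pre_iff) metis
  qed
  have notM: "s n \<notin> M x" if "n \<in> I" for n x
    using that unfolding M_def by (auto simp: pre_iff)
  obtain W where W: "open W" "{e} \<subseteq> W" "pre W \<subseteq> (\<Union>x\<in>pre {e}. M x)"
    by (rule closed_map_tube[of "\<Union>x\<in>pre {e}. M x" "{e}"]) (use M in auto)
  have "eventually (\<lambda>n. f (s n) \<in> W) sequentially"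
    using lim W topological_tendstoD by fastforce
  then obtain n0 where "\<And>n. n \<ge> n0 \<Longrightarrow> f (s n) \<in> W"
    unfolding eventually_sequentially by blast
  moreover obtain n where "n \<in> I" "n \<ge> n0"
    using I by (meson infinite_nat_iff_unbounded_le)
  ultimately have "s n \<in> pre W" "n \<in> I"
    using s by (auto simp: pre_iff)
  then show False
    using W notM by blast
qed

section \<open>Minimal compact convex sets joining two points\<close>

text \<open>Small neighborhoods are joined over bounded sets, so the points joined to
  \<open>p\<close> over some ball form an open set with open complement, and \<open>X\<close> is
  connected. This gives Zorn's lemma its starting element.\<close>

lemma joined_bounded:
  assumes p: "p \<in> topspace X" and q: "q \<in> topspace X"
  obtains R where "joined (cball 0 R) p q"
proof -
  define A where "A = {y. \<exists>R. joined (cball 0 R) p y}"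
  have "\<exists>N R. openin X N \<and> y \<in> N \<and> (\<forall>u\<in>N. \<forall>u'\<in>N. joined (cball 0 R) u u')" if y: "y \<in> topspace X" for y
  proof -
    obtain N \<delta> where N: "openin X N" "y \<in> N" "0 < \<delta>"
      and j: "\<And>T u u'. convex T \<Longrightarrow> T \<subseteq> ball (f y) \<delta> \<Longrightarrow> u \<in> N \<Longrightarrow> u' \<in> N \<Longrightarrow> f u \<in> T \<Longrightarrow> f u' \<in> T
      \<Longrightarrow> joined T u u'"
      using locally_joined[OF y] by metis
    have sub: "ball (f y) \<delta> \<subseteq> cball 0 (norm (f y) + \<delta>)"
    proof
      fix v assume "v \<in> ball (f y) \<delta>"
      then show "v \<in> cball 0 (norm (f y) + \<delta>)"
        using norm_triangle_sub[of v "f y"] by (simp add: dist_norm norm_minus_commute)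
    qed
    have "joined (cball 0 (norm (f y) + \<delta>)) u u'"
      if "u \<in> N \<inter> pre (ball (f y) \<delta>)" "u' \<in> N \<inter> pre (ball (f y) \<delta>)" for u u'
      using that j[of "ball (f y) \<delta>" u u'] joined_mono[OF _ sub] by (auto simp: pre_iff)
    moreover have "openin X (N \<inter> pre (ball (f y) \<delta>))"
      using N openin_pre by blast
    moreover have "y \<in> N \<inter> pre (ball (f y) \<delta>)"
      using N y by (auto simp: pre_iff)
    ultimately show ?thesis
      by blast
  qed
  then obtain N R where N: "\<And>y. y \<in> topspace X \<Longrightarrow>
      openin X (N y) \<and> y \<in> N y \<and> (\<forall>u\<in>N y. \<forall>u'\<in>N y. joined (cball 0 (R y)) u u')"
    by metis
  have step: "u' \<in> A" if u: "y \<in> topspace X" "u \<in> N y" "u' \<in> N y" "u \<in> A" for y u u'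
  proof -
    obtain R' where "joined (cball 0 R') p u"
      using u unfolding A_def by blast
    then have "joined (cball 0 (max R' (R y))) p u"
      by (rule joined_mono) auto
    moreover have "joined (cball 0 (max R' (R y))) u u'"
      by (rule joined_mono[of "cball 0 (R y)"]) (use N u in auto)
    ultimately show ?thesis
      unfolding A_def using joined_trans by blast
  qed
  have "q \<in> (\<Union>y\<in>topspace X \<inter> A. N y)"
  proof (rule connected_on_side[of "topspace X"])
    show "connectedin X (topspace X)"
      using connected by (simp add: connectedin_topspace)
    have "openin X (\<Union>y\<in>topspace X \<inter> A. N y)" "openin X (\<Union>y\<in>topspace X - A. N y)"
      using N by auto
    then show "openin X (\<Union>y\<in>topspace X \<inter> A. N y) \<and> openin X (\<Union>y\<in>topspace X - A. N y) \<or>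
      closedin X (\<Union>y\<in>topspace X \<inter> A. N y) \<and> closedin X (\<Union>y\<in>topspace X - A. N y)"
      by blast
    show "topspace X \<subseteq> (\<Union>y\<in>topspace X \<inter> A. N y) \<union> (\<Union>y\<in>topspace X - A. N y)"
      using N by blast
    show "(\<Union>y\<in>topspace X \<inter> A. N y) \<inter> (\<Union>y\<in>topspace X - A. N y) \<inter> topspace X = {}"
      using N step by blast
    have "joined (cball 0 (norm (f p))) p p"
      using p by (simp add: joined_refl pre_iff)
    then have "p \<in> A"
      unfolding A_def by blast
    then show "p \<in> (\<Union>y\<in>topspace X \<inter> A. N y)"
      using N p by blast
  qed (use p q in auto)
  then have "q \<in> A"
    using N step by blast
  then show thesis
    using that unfolding A_def by blast
qed

lemma joined_minimal:
  assumes "p \<in> topspace X" "q \<in> topspace X"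
  obtains S where "compact S" "convex S" "joined S p q"
    "\<And>S'. compact S' \<Longrightarrow> convex S' \<Longrightarrow> S' \<subseteq> S \<Longrightarrow> joined S' p q \<Longrightarrow> S' = S"
proof -
  \<comment> \<open>Complements turn minimal sets into maximal ones and intersections of chains into
    unions, as \<open>subset_Zorn_nonempty\<close> expects.\<close>
  define \<A> where "\<A> = {U. compact (- U) \<and> convex (- U) \<and> joined (- U) p q}"
  obtain R where "joined (cball 0 R) p q"
    using joined_bounded assms by blast
  then have "- cball 0 R \<in> \<A>"
    by (simp add: \<A>_def)
  then have "\<A> \<noteq> {}"
    by blast
  moreover have "\<Union>\<C> \<in> \<A>" if C: "\<C> \<noteq> {}" "subset.chain \<A> \<C>" for \<C>
  proof -
    have CA: "\<C> \<subseteq> \<A>"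
      using C by (simp add: subset.chain_def)
    obtain U0 where U0: "U0 \<in> \<C>"
      using C by blast
    have eq: "- \<Union>\<C> = (\<Inter>U\<in>\<C>. - U)"
      by blast
    have op: "open U" if "U \<in> \<C>" for U
      using that CA compact_imp_closed[of "- U"] unfolding \<A>_def by (auto simp: closed_def)
    have cl: "closed (- \<Union>\<C>)"
      using op by (simp add: closed_def open_Union)
    have "- \<Union>\<C> = - U0 \<inter> - \<Union>\<C>"
      using U0 by blast
    then have "compact (- \<Union>\<C>)"
      using cl U0 CA compact_Int_closed[of "- U0" "- \<Union>\<C>"] unfolding \<A>_def by force
    moreover have conv: "convex (- \<Union>\<C>)"
      unfolding eq using CA by (intro convex_INT) (auto simp: \<A>_def)
    moreover have "joined (- \<Union>\<C>) p q"
    proof (rule ccontr)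
      assume nj: "\<not> ?thesis"
      have "p \<in> pre (- U) \<and> q \<in> pre (- U)" if "U \<in> \<C>" for U
        using that CA joined_in[of "- U" p q] unfolding \<A>_def by blast
      then have pq: "p \<in> pre (- \<Union>\<C>)" "q \<in> pre (- \<Union>\<C>)"
        using assms by (auto simp: pre_iff)
      obtain E1 E2 W where E: "openin X E1" "openin X E2" "E1 \<inter> E2 = {}" "{y. joined (- \<Union>\<C>) p y} \<subseteq> E1"
        "{y \<in> pre (- \<Union>\<C>). \<not> joined (- \<Union>\<C>) p y} \<subseteq> E2" and W: "open W" "- \<Union>\<C> \<subseteq> W" "pre W \<subseteq> E1 \<union> E2"
        by (rule separate_component[OF conv cl pq(1)])
      \<comment> \<open>By compactness finitely many chain members cover what lies outside
        \<open>W\<close>; the largest of them has its complement inside \<open>W\<close>, where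
        \<open>p\<close> and \<open>q\<close> are already separated.\<close>
      have "compact (- U0 - W)"
        using U0 CA W unfolding \<A>_def by (auto intro: compact_diff)
      moreover have "- U0 - W \<subseteq> \<Union>\<C>"
        using W by blast
      ultimately obtain \<D> where D: "\<D> \<subseteq> \<C>" "finite \<D>" "- U0 - W \<subseteq> \<Union>\<D>"
        using op by (metis compactE)
      have "subset.chain \<A> (insert U0 \<D>)"
        using C(2) D(1) U0 unfolding subset_chain_def by (metis insert_subset subset_iff)
      then have "\<Union>(insert U0 \<D>) \<in> insert U0 \<D>"
        using D Union_in_chain[of "insert U0 \<D>" \<A>] by blast
      then have mem: "\<Union>(insert U0 \<D>) \<in> \<C>"
        using D(1) U0 by (metis insert_subset subset_iff)
      define U where "U = \<Union>(insert U0 \<D>)"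
      have U: "U \<in> \<C>" "- U \<subseteq> W"
        using mem D(3) unfolding U_def by auto
      then obtain L where L: "connectedin X L" "L \<subseteq> pre (- U)" "p \<in> L" "q \<in> L"
        using CA unfolding \<A>_def joined_iff by blast
      have LE: "L \<subseteq> E1 \<union> E2"
        using L(2) U(2) W(3) by (auto simp: pre_def)
      have "p \<in> E1" "q \<in> E2"
        using E pq nj joined_refl by auto
      then have "q \<in> E1"
        using connected_on_side[of L E1 E2 p q] L LE E by blast
      then show False
        using \<open>q \<in> E2\<close> E by blast
    qed
    ultimately show ?thesis
      by (simp add: \<A>_def)
  qed
  ultimately obtain M where M: "M \<in> \<A>" "\<And>U. U \<in> \<A> \<Longrightarrow> M \<subseteq> U \<Longrightarrow> U = M"
    using subset_Zorn_nonempty[of \<A>] by blast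
  show thesis
  proof
    show "S' = - M" if "compact S'" "convex S'" "S' \<subseteq> - M" "joined S' p q" for S'
      using M(2)[of "- S'"] that unfolding \<A>_def by auto
  qed (use M in \<open>auto simp: \<A>_def\<close>)
qed

lemma minimal_is_segment:
  assumes S: "compact S" "convex S" "joined S p q"
    and min: "\<And>S'. compact S' \<Longrightarrow> convex S' \<Longrightarrow> S' \<subseteq> S \<Longrightarrow> joined S' p q \<Longrightarrow> S' = S"
  shows "S \<subseteq> closed_segment (f p) (f q)"
proof
  fix s assume s: "s \<in> S"
  show "s \<in> closed_segment (f p) (f q)"
  proof (rule ccontr)
    assume "s \<notin> closed_segment (f p) (f q)"
    then obtain e u where e: "e \<in> S" "\<And>x. x \<in> S \<Longrightarrow> (norm (x - e))\<^sup>2 \<le> 2 * (u \<bullet> e - u \<bullet> x)"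
      and pq: "u \<bullet> f p < u \<bullet> e" "u \<bullet> f q < u \<bullet> e"
      using shrinking_caps[OF S(1) s] by metis
    \<comment> \<open>With this gap every cut height \<open>c n\<close>, the lowest one
      \<open>c 0\<close> included, leaves \<open>f p\<close> and \<open>f q\<close> on the lower
      side while cutting off \<open>e\<close>.\<close>
    define \<epsilon> where "\<epsilon> = min (u \<bullet> e - u \<bullet> f p) (u \<bullet> e - u \<bullet> f q)"
    have \<epsilon>: "\<epsilon> > 0"
      using pq by (simp add: \<epsilon>_def)
    define c where "c n = u \<bullet> e - \<epsilon> / real (Suc n)" for n
    have ce: "c n < u \<bullet> e" for n
      using \<epsilon> by (simp add: c_def)
    have "\<epsilon> / real (Suc n) \<le> \<epsilon>" for n
      using \<epsilon> by (simp add: divide_le_eq)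
    then have cpq: "u \<bullet> f p \<le> c n" "u \<bullet> f q \<le> c n" for n
      unfolding c_def \<epsilon>_def by (smt (verit))+
    define S' where "S' n = S \<inter> {v. u \<bullet> v \<le> c n}" for n
    define T where "T n = S \<inter> {v. u \<bullet> v \<ge> c n}" for n
    have S': "compact (S' n)" "convex (S' n)" for n
      unfolding S'_def using S by (auto intro: compact_Int_closed convex_Int closed_halfspace_le convex_halfspace_le)
    have T: "compact (T n)" "convex (T n)" for n
      unfolding T_def using S by (auto intro: compact_Int_closed convex_Int closed_halfspace_ge convex_halfspace_ge)
    have pqS: "p \<in> pre (S' n)" "q \<in> pre (S' n)" for n
      using joined_in[OF S(3)] cpq unfolding S'_def by (auto simp: pre_iff)
    \<comment> \<open>The lower part omits \<open>e\<close>, so it is a proper subset of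
      \<open>S\<close> and minimality applies.\<close>
    have nj: "\<not> joined (S' n) p q" for n
    proof
      assume "joined (S' n) p q"
      then have "S' n = S"
        using min[OF S', of n] unfolding S'_def by blast
      then have "u \<bullet> e \<le> c n"
        using e(1) unfolding S'_def by blast
      then show False
        using ce[of n] by simp
    qed
    have un: "S' n \<union> T n = S" for n
      unfolding S'_def T_def by auto
    have "\<exists>x y. f x \<in> S' n \<inter> T n \<and> f y \<in> S' n \<inter> T n \<and> joined (S' n) p x \<and> \<not> joined (S' n) p y
        \<and> joined (T n) x y" for n
      using joined_across_cut[OF S'(2) compact_imp_closed[OF S'(1)] T(2) compact_imp_closed[OF T(1)] _ nj pqS, of n n]
        S(3) unfolding un by metis
    then obtain x y where xy: "\<And>n. f (x n) \<in> S' n \<inter> T n" "\<And>n. f (y n) \<in> S' n \<inter> T n"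
      "\<And>n. joined (S' n) p (x n)" "\<And>n. \<not> joined (S' n) p (y n)" "\<And>n. joined (T n) (x n) (y n)"
      by metis
    have top: "x n \<in> topspace X" "y n \<in> topspace X" for n
      using joined_in[OF xy(5)[of n]] by (auto simp: pre_iff)
    have "(\<lambda>n. 2 * (\<epsilon> * inverse (real (Suc n)))) \<longlonglongrightarrow> 2 * (\<epsilon> * 0)"
      by (intro tendsto_intros LIMSEQ_inverse_real_of_nat)
    then have lim0: "(\<lambda>n. 2 * (\<epsilon> / real (Suc n))) \<longlonglongrightarrow> 0"
      by (simp add: divide_inverse)
    have small: "(norm (v - e))\<^sup>2 \<le> 2 * (\<epsilon> / real (Suc n))" if "v \<in> T n" for v n
      using e(2)[of v] that unfolding T_def c_def by auto
    have caps: "eventually (\<lambda>n. T n \<subseteq> ball e r) sequentially" if r: "r > 0" for r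
    proof -
      have "eventually (\<lambda>n. 2 * (\<epsilon> / real (Suc n)) < r\<^sup>2) sequentially"
        using order_tendstoD(2)[OF lim0, of "r\<^sup>2"] r by simp
      then show ?thesis
      proof eventually_elim
        case (elim n)
        show ?case
        proof
          fix v assume "v \<in> T n"
          then have "(norm (v - e))\<^sup>2 < r\<^sup>2"
            using small elim by (meson le_less_trans)
          then show "v \<in> ball e r"
            using r by (simp add: power2_less_imp_less dist_norm norm_minus_commute)
        qed
      qed
    qed
    have lim: "(\<lambda>n. f (z n)) \<longlonglongrightarrow> e" if z: "\<And>n. f (z n) \<in> T n" for z
      unfolding tendsto_iff
    proof (intro allI impI)
      fix r :: real assume "0 < r"
      show "\<forall>\<^sub>F n in sequentially. dist (f (z n)) e < r"
        using caps[OF \<open>0 < r\<close>]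
      proof eventually_elim
        case (elim n)
        then show ?case
          using z[of n] by (auto simp: dist_commute)
      qed
    qed
    \<comment> \<open>Points over the cut lie strictly below \<open>e\<close>, as
      \<open>fiber_cluster_point\<close> requires.\<close>
    have ne: "f (x n) \<noteq> e" "f (y n) \<noteq> e" for n
      using xy(1,2)[of n] ce[of n] unfolding S'_def by auto
    obtain x0 where x0: "x0 \<in> pre {e}"
      and clx: "\<And>N. openin X N \<Longrightarrow> x0 \<in> N \<Longrightarrow> infinite {n \<in> UNIV. x n \<in> N}"
      by (rule fiber_cluster_point[of x e UNIV]) (use top lim[of x] xy ne in auto)
    have x0X: "x0 \<in> topspace X" "f x0 = e"
      using x0 by (auto simp: pre_iff)
    obtain N \<delta> where N: "openin X N" "x0 \<in> N" "0 < \<delta>"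
      and j: "\<And>T u u'. convex T \<Longrightarrow> T \<subseteq> ball e \<delta> \<Longrightarrow> u \<in> N \<Longrightarrow> u' \<in> N \<Longrightarrow> f u \<in> T \<Longrightarrow> f u' \<in> T
        \<Longrightarrow> joined T u u'"
      using locally_joined[OF x0X(1)] unfolding x0X(2) by metis
    \<comment> \<open>The component of \<open>x0\<close> in the fiber over \<open>e\<close> is split
      off from the rest of that fiber, and the splitting extends to all caps inside
      \<open>W\<close>.\<close>
    obtain E1 E2 W where E: "openin X E1" "openin X E2" "E1 \<inter> E2 = {}" "{y. joined {e} x0 y} \<subseteq> E1"
      "{y \<in> pre {e}. \<not> joined {e} x0 y} \<subseteq> E2" and W: "open W" "{e} \<subseteq> W" "pre W \<subseteq> E1 \<union> E2"
      by (rule separate_component[OF _ _ x0]) simp_all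
    obtain r where r: "r > 0" "ball e r \<subseteq> W"
      using W by (meson insert_subset open_contains_ball)
    obtain n0 where n0: "\<And>n. n \<ge> n0 \<Longrightarrow> T n \<subseteq> ball e r \<and> T n \<subseteq> ball e \<delta>"
      using eventually_conj[OF caps[OF r(1)] caps[OF N(3)]] unfolding eventually_sequentially by blast
    \<comment> \<open>These indices have \<open>x n\<close> near \<open>x0\<close> on the side
      \<open>E1\<close> and a cap small enough for \<open>W\<close> and \<open>\<delta>\<close>; the
      \<open>y n\<close> are made to cluster along them.\<close>
    define I where "I = {n. x n \<in> N \<inter> E1} - {..<n0}"
    have "x0 \<in> E1"
      using E(4) x0 joined_refl by blast
    then have "infinite {n. x n \<in> N \<inter> E1}"
      using clx[of "N \<inter> E1"] N E by auto
    then have "infinite I"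
      unfolding I_def by (rule Diff_infinite_finite[rotated]) simp
    have I: "x n \<in> N" "x n \<in> E1" "T n \<subseteq> ball e r" "T n \<subseteq> ball e \<delta>" if "n \<in> I" for n
      using that n0 unfolding I_def by auto
    obtain y0 where y0: "y0 \<in> pre {e}"
      and cly: "\<And>N. openin X N \<Longrightarrow> y0 \<in> N \<Longrightarrow> infinite {n \<in> I. y n \<in> N}"
      by (rule fiber_cluster_point[of y e I]) (use top lim[of y] xy ne \<open>infinite I\<close> in auto)
    \<comment> \<open>Otherwise some \<open>y n\<close> would lie in \<open>E2\<close>, although it
      is connected through its cap to \<open>x n\<close> in \<open>E1\<close>.\<close>
    have "joined {e} x0 y0"
    proof (rule ccontr)
      assume "\<not> ?thesis"
      then have "y0 \<in> E2"
        using E y0 by blast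
      then obtain n where n: "n \<in> I" "y n \<in> E2"
        using cly[OF E(2)] not_finite_existsD by blast
      obtain L where L: "connectedin X L" "L \<subseteq> pre (T n)" "x n \<in> L" "y n \<in> L"
        using xy(5)[of n] unfolding joined_iff by blast
      have "L \<subseteq> E1 \<union> E2"
        using L(2) I(3)[OF n(1)] r(2) W(3) by (auto simp: pre_def)
      then have "y n \<in> E1"
        using connected_on_side[of L E1 E2 "x n" "y n"] L I[OF n(1)] E by blast
      then show False
        using n E by blast
    qed
    moreover have "f y0 = e"
      using y0 by (simp add: pre_iff)
    \<comment> \<open>The fiber saturation of \<open>N\<close> is open and contains
      \<open>y0\<close>, so it contains some \<open>y n\<close>, which is thus connected inside its
      own fiber to a point \<open>v\<close> of \<open>N\<close>.\<close>
    ultimately have "y0 \<in> {w. \<exists>v\<in>N. joined {f w} w v}"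
      using N(2) joined_sym by blast
    then obtain n v where n: "n \<in> I" "v \<in> N" "joined {f (y n)} (y n) v"
      using cly[OF openin_fiber_saturation[OF N(1)]] not_finite_existsD by blast
    have fv: "f v = f (y n)"
      using joined_in[OF n(3)] by (simp add: pre_iff)
    \<comment> \<open>Both \<open>x n\<close> and \<open>v\<close> are in \<open>N\<close> with
      values on the cut, which is convex and small, so they are joined without leaving
      \<open>S' n\<close>. Continuing to \<open>y n\<close> in its fiber contradicts the choice of
      the pair.\<close>
    have "joined (S' n \<inter> T n) (x n) v"
    proof (rule j)
      show "convex (S' n \<inter> T n)"
        using S' T by (blast intro: convex_Int)
      show "S' n \<inter> T n \<subseteq> ball e \<delta>"
        using I(4)[OF n(1)] by (rule le_infI2)
    qed (use n fv xy(1,2)[of n] I(1) in simp_all)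
    moreover have "joined (S' n \<inter> T n) v (y n)"
      using joined_mono[OF joined_sym[OF n(3)]] xy(2) by auto
    ultimately have "joined (S' n) (x n) (y n)"
      using joined_trans joined_mono[OF _ Int_lower1] by blast
    then show False
      using xy(3,4) joined_trans by blast
  qed
qed

lemma joined_closed_segment:
  assumes "p \<in> topspace X" "q \<in> topspace X"
  shows "joined (closed_segment (f p) (f q)) p q"
proof -
  obtain S where S: "compact S" "convex S" "joined S p q"
    "\<And>S'. compact S' \<Longrightarrow> convex S' \<Longrightarrow> S' \<subseteq> S \<Longrightarrow> joined S' p q \<Longrightarrow> S' = S"
    by (rule joined_minimal[OF assms]) auto
  show ?thesis
    by (rule joined_mono[OF S(3)]) (rule minimal_is_segment[OF S])
qed

section \<open>Fibers, convexity and openness of the image map\<close>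

text \<open>For two points over \<open>v\<close> the joining segment degenerates to
  \<open>{v}\<close>.\<close>

lemma connectedin_fiber: "connectedin X (pre {v})"
proof -
  have "joined {v} x y" if "x \<in> pre {v}" "y \<in> pre {v}" for x y
    using that joined_closed_segment[of x y] by (simp add: pre_iff)
  then show ?thesis
    using topspace_pre[of "{v}"]
    unfolding connectedin_def connected_space_iff_connected_component joined_def pre_def by auto
qed

text \<open>A connected set joining \<open>p\<close> and \<open>q\<close> over the segment has a
  connected collinear image, which is convex and so contains the whole segment.\<close>

lemma convex_image: "convex (f ` topspace X)"
proof -
  have "closed_segment (f p) (f q) \<subseteq> f ` topspace X" if pq: "p \<in> topspace X" "q \<in> topspace X" for p q
  proof -
    obtain L where L: "connectedin X L" "L \<subseteq> pre (closed_segment (f p) (f q))" "p \<in> L" "q \<in> L"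
      using joined_closed_segment[OF pq] unfolding joined_iff by blast
    have "connected (f ` L)"
      using connectedin_continuous_map_image[OF continuous L(1)] by simp
    moreover have "collinear (f ` L)"
      by (rule collinear_subset[OF collinear_closed_segment[of "f p" "f q"]]) (use L(2) in \<open>auto simp: pre_def\<close>)
    ultimately have "convex (f ` L)"
      by (simp add: convex_connected_collinear)
    then have "closed_segment (f p) (f q) \<subseteq> f ` L"
      using L by (simp add: closed_segment_subset)
    then show ?thesis
      using L(2) by (auto simp: pre_def)
  qed
  then show ?thesis
    unfolding convex_contains_segment by blast
qed

lemma open_map_onto_image: "open_map X (top_of_set (f ` topspace X)) f"
  unfolding open_map_def
proof (intro allI impI)
  fix U assume U: "openin X U"
  have "{x. \<exists>y\<in>U. joined {f x} x y} = pre (f ` U)"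
  proof (intro equalityI subsetI)
    fix x assume "x \<in> pre (f ` U)"
    then obtain y where y: "y \<in> U" "f y = f x" "x \<in> topspace X"
      by (auto simp: pre_iff)
    then have "joined {f x} x y"
      using joined_closed_segment[of x y] U openin_subset by fastforce
    then show "x \<in> {x. \<exists>y\<in>U. joined {f x} x y}"
      using y by blast
  next
    fix x assume "x \<in> {x. \<exists>y\<in>U. joined {f x} x y}"
    then obtain y where "y \<in> U" "joined {f x} x y"
      by blast
    then show "x \<in> pre (f ` U)"
      using joined_in[of "{f x}" x y] by (auto simp: pre_iff intro: rev_image_eqI)
  qed
  then have "openin X (pre (f ` U))"
    using openin_fiber_saturation[OF U] by simp
  then obtain W where W: "open W" "f ` U \<subseteq> W" "pre W \<subseteq> pre (f ` U)"
    by (rule closed_map_tube[OF _ order_refl])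
  then have "f ` U = f ` topspace X \<inter> W"
    using openin_subset[OF U] by (auto simp: pre_def)
  then show "openin (top_of_set (f ` topspace X)) (f ` U)"
    using W(1) by (simp add: openin_open_Int)
qed

end

theorem theorem2p27:
  fixes X :: "'a topology" and f :: "'a \<Rightarrow> 'b::euclidean_space"
  assumes "connected_space X" and "locally_connected_space X" and "Hausdorff_space X"
    and "first_countable X" and "normal_space X"
    and "continuous_map X euclidean f" and "closed_map X euclidean f"
    and "has_local_convexity_data X f" and "locally_fiber_connected_map X f"
  shows "(\<forall>v. connectedin X {x \<in> topspace X. f x = v})
    \<and> open_map X (subtopology euclidean (f ` topspace X)) f
    \<and> closed (f ` topspace X) \<and> convex (f ` topspace X)"
proof -
  interpret local_convexity_map X f
    using assms by unfold_locales
  have "closed (f ` topspace X)"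
    using closed_map unfolding closed_map_def by auto
  moreover have "connectedin X {x \<in> topspace X. f x = v}" for v
    using connectedin_fiber[of v] by (simp add: pre_def)
  ultimately show ?thesis
    using open_map_onto_image convex_image by blast
qed

end
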